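(* There exists an absolute constant $c>0$ such that for every integer $n\ge 2$ there exist a set of at most $n$ points and a set of at most $n$ hyperplanes (planes) in $\mathbb{R}^3$ whose incidence matrix $M_{\mathrm{hyp}}$ satisfies $$\gamma_2(M_{\mathrm{hyp}})\ \ge\ c\,\frac{n^{1/4}}{\sqrt{\log n}}.$$
   Context: Incidence matrix: for a set $P$ of points and a set $\mathcal{H}$ of hyperplanes, it is the Boolean matrix with rows indexed by $\mathcal{H}$, columns indexed by $P$, and entry $M(H,x)=1$ if $x\in H$ and $0$ otherwise. $\gamma_2$-norm: for $M\in\mathbb{C}^{m\times n}$, $\gamma_2(M)=\min_{M=UV}\|U\|_{\mathrm{row}}\|V\|_{\mathrm{col}}$, where the minimum is over all factorizations $M=UV$ into complex matrices, $\|U\|_{\mathrm{row}}$ is the maximum $\ell_2$-norm of a row of $U$, and $\|V\|_{\mathrm{col}}$ is the maximum $\ell_2$-norm of a column of $V$. *)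

theory Defs
  imports "HOL-Analysis.Analysis" "Jordan_Normal_Form.Matrix"
begin

definition hyperplane :: "'a::euclidean_space set \<Rightarrow> bool" where
  "hyperplane h \<longleftrightarrow> (\<exists>a b. a \<noteq> 0 \<and> h = {x. a \<bullet> x = b})"

text \<open>Matrices of the type \<^typ>\<open>'a mat\<close> are indexed by numbers, so the incidence matrix of finite
  sets of points and hyperplanes is taken with respect to enumerations \<^term>\<open>hs\<close> and \<^term>\<open>ps\<close>
  of the two sets.\<close>

definition incidence_mat :: "'a set list \<Rightarrow> 'a list \<Rightarrow> complex mat" where
  "incidence_mat hs ps =
     mat (length hs) (length ps) (\<lambda>(i, j). if ps ! j \<in> hs ! i then 1 else 0)"

text \<open>The inserted 0 only matters for matrices without rows (respectively without columns).\<close>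

definition row_norm :: "complex mat \<Rightarrow> real" where
  "row_norm U =
     Max (insert 0 ((\<lambda>i. L2_set (\<lambda>j. cmod (U $$ (i, j))) {..<dim_col U}) ` {..<dim_row U}))"

definition col_norm :: "complex mat \<Rightarrow> real" where
  "col_norm V =
     Max (insert 0 ((\<lambda>j. L2_set (\<lambda>i. cmod (V $$ (i, j))) {..<dim_row V}) ` {..<dim_col V}))"

text \<open>The inner dimension of the factorization is arbitrary. The minimum is written as an infimum;
  the two lemmas below show that this is the infimum of a nonempty set that is bounded below.\<close>

definition gamma2_values :: "complex mat \<Rightarrow> real set" where
  "gamma2_values M =
     {row_norm U * col_norm V | U V k.
        U \<in> carrier_mat (dim_row M) k \<and> V \<in> carrier_mat k (dim_col M) \<and> M = U * V}"

definition gamma2 :: "complex mat \<Rightarrow> real" where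
  "gamma2 M = Inf (gamma2_values M)"

lemma gamma2_values_nonempty: "gamma2_values M \<noteq> {}"
proof -
  have "M = M * 1\<^sub>m (dim_col M)"
    by simp
  then have "row_norm M * col_norm (1\<^sub>m (dim_col M)) \<in> gamma2_values M"
    unfolding gamma2_values_def by (blast intro: carrier_matI one_carrier_mat)
  then show ?thesis
    by blast
qed

lemma gamma2_values_bdd_below: "bdd_below (gamma2_values M)"
proof (rule bdd_belowI)
  fix x
  assume "x \<in> gamma2_values M"
  moreover have "row_norm U \<ge> 0" "col_norm U \<ge> 0" for U
    unfolding row_norm_def col_norm_def by (auto intro: Max_ge)
  ultimately show "0 \<le> x"
    unfolding gamma2_values_def by auto
qed

end

theory Submission
  imports Defs "Jordan_Normal_Form.Determinant"
begin

text \<open>If \<open>M = U V\<close> is \<open>m \<times> n\<close>, then the trace norm of \<open>M\<close> is at most the product of the Frobenius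
  norms of \<open>U\<close> and \<open>V\<close>, hence at most \<open>sqrt (m n)\<close> times the \<open>\<gamma>\<^sub>2\<close>-norm. By Hoelder's inequality
  for Schatten norms the trace norm is at least the cube of the Frobenius norm divided by the square
  of the Schatten 4-norm. For an incidence matrix the squared Frobenius norm counts incidences, and
  the fourth power of the Schatten 4-norm counts pairs of points together with pairs of planes
  through both. Take the planes \<open>z = a x + b y + c\<close> with \<open>a, b < X\<close> and \<open>c < X\<^sup>2\<close>, and all the
  integer points with \<open>x, y < X\<close> on them: this gives \<open>X ^ 6\<close> incidences between order \<open>X ^ 4\<close> points
  and planes. The second count is at most \<open>X ^ 6\<close> times the number of solutions of
  \<open>\<alpha> u + \<beta> v = 0\<close> in integers below \<open>X\<close>, which is of order \<open>X\<^sup>2 log X\<close>.\<close>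

section \<open>Trace norm bound for real factorizations\<close>

text \<open>The transpose is the adjoint of \<open>M\<close>, so one factor of \<open>M M^T\<close>
  moves across the inner product. For \<open>y = x\<close> the right side is a sum of
  squares.\<close>

lemma gram_form:
  fixes M :: "nat \<Rightarrow> 'j \<Rightarrow> real"
  shows "(\<Sum>i<m. y i * (\<Sum>j\<in>J. M i j * (\<Sum>k<m. M k j * x k)))
    = (\<Sum>j\<in>J. (\<Sum>i<m. M i j * y i) * (\<Sum>i<m. M i j * x i))"
proof -
  have "(\<Sum>i<m. y i * (\<Sum>j\<in>J. M i j * (\<Sum>k<m. M k j * x k)))
    = (\<Sum>i<m. \<Sum>j\<in>J. M i j * y i * (\<Sum>k<m. M k j * x k))"
    by (simp add: sum_distrib_left mult_ac)
  also have "\<dots> = (\<Sum>j\<in>J. (\<Sum>i<m. M i j * y i) * (\<Sum>i<m. M i j * x i))"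
    by (subst sum.swap) (simp add: sum_distrib_right)
  finally show ?thesis .
qed

text \<open>Adding \<open>t I\<close> to the positive semidefinite \<open>M M^T\<close> makes it
  invertible: a kernel vector \<open>v\<close> would satisfy
  \<open>|M^T v|^2 + t |v|^2 = 0\<close>.\<close>

lemma regularized_solution:
  fixes M :: "nat \<Rightarrow> 'j \<Rightarrow> real"
  assumes t: "t > 0"
  obtains x where "\<And>i. i < m \<Longrightarrow> (\<Sum>j\<in>J. M i j * (\<Sum>k<m. M k j * x k)) + t * x i = b i"
proof -
  define A where
    "A = mat m m (\<lambda>(i, k). (\<Sum>j\<in>J. M i j * M k j) + (if i = k then t else 0))"
  have A: "A \<in> carrier_mat m m"
    by (simp add: A_def)
  have app: "(A *\<^sub>v v) $ i = (\<Sum>j\<in>J. M i j * (\<Sum>k<m. M k j * v $ k)) + t * v $ i"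
    if "v \<in> carrier_vec m" "i < m" for v i
  proof -
    have "(A *\<^sub>v v) $ i = (\<Sum>k<m. ((\<Sum>j\<in>J. M i j * M k j) + (if i = k then t else 0)) * v $ k)"
      using that by (simp add: A_def scalar_prod_def atLeast0LessThan)
    also have "\<dots> = (\<Sum>k<m. \<Sum>j\<in>J. M i j * (M k j * v $ k)) + t * v $ i"
      using that by (simp add: distrib_right sum.distrib sum_distrib_right mult.assoc
          if_distrib[where f = "\<lambda>c. c * _"] cong: if_cong)
    also have "(\<Sum>k<m. \<Sum>j\<in>J. M i j * (M k j * v $ k)) = (\<Sum>j\<in>J. M i j * (\<Sum>k<m. M k j * v $ k))"
      by (subst sum.swap) (simp add: sum_distrib_left)
    finally show ?thesis .
  qed
  have "det A \<noteq> 0"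
  proof
    assume "det A = 0"
    then obtain v where v: "v \<in> carrier_vec m" "v \<noteq> 0\<^sub>v m" "A *\<^sub>v v = 0\<^sub>v m"
      using det_0_iff_vec_prod_zero[OF A] by auto
    have "0 = (\<Sum>i<m. v $ i * (A *\<^sub>v v) $ i)"
      using v by simp
    also have "\<dots> = (\<Sum>i<m. v $ i * (\<Sum>j\<in>J. M i j * (\<Sum>k<m. M k j * v $ k))) + t * (\<Sum>i<m. (v $ i)\<^sup>2)"
      using v(1) by (simp add: app sum.distrib sum_distrib_left distrib_left power2_eq_square mult_ac)
    also have "\<dots> = (\<Sum>j\<in>J. (\<Sum>i<m. M i j * v $ i)\<^sup>2) + t * (\<Sum>i<m. (v $ i)\<^sup>2)"
      by (simp add: gram_form power2_eq_square)
    finally have "t * (\<Sum>i<m. (v $ i)\<^sup>2) \<le> 0"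
      by (smt (verit) sum_nonneg zero_le_power2)
    then have "(\<Sum>i<m. (v $ i)\<^sup>2) \<le> 0"
      using t by (simp add: mult_le_0_iff)
    then have "(\<Sum>i<m. (v $ i)\<^sup>2) = 0"
      by (meson antisym sum_nonneg zero_le_power2)
    then have "\<forall>i<m. v $ i = 0"
      by (simp add: sum_nonneg_eq_0_iff)
    then have "v = 0\<^sub>v m"
      using v(1) by auto
    with v(2) show False ..
  qed
  then obtain B where B: "B \<in> carrier_mat m m" "A * B = 1\<^sub>m m"
    using det_non_zero_imp_unit[OF A, of "()"] by (auto simp: Units_def ring_mat_simps)
  define x where "x = B *\<^sub>v vec m b"
  have x: "x \<in> carrier_vec m"
    using B by (simp add: x_def)
  have "A *\<^sub>v x = vec m b"
    unfolding x_def using A B by (simp flip: assoc_mult_mat_vec)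
  then have "(\<Sum>j\<in>J. M i j * (\<Sum>k<m. M k j * x $ k)) + t * x $ i = b i" if "i < m" for i
    using app[OF x that] that by simp
  then show thesis
    by (rule that)
qed

text \<open>With \<open>t\<close> the quotient of the sums of the fourth powers and of the squares of the
  singular values, the matrix \<open>Q = (M M\<^sup>T + t I)\<^sup>-\<^sup>1 M\<close> has operator norm at most \<open>1 / (2 sqrt t)\<close>, and pairing it with
  \<open>M\<close> bounds the trace norm of \<open>M\<close> from below.\<close>

lemma factorization_lower_bound:
  fixes M :: "nat \<Rightarrow> 'j \<Rightarrow> real" and u :: "nat \<Rightarrow> 'l \<Rightarrow> real" and v :: "'l \<Rightarrow> 'j \<Rightarrow> real"
  assumes fin: "finite J"
    and fac: "\<And>i j. i < m \<Longrightarrow> j \<in> J \<Longrightarrow> M i j = (\<Sum>l\<in>L. u i l * v l j)"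
  shows "(\<Sum>i<m. \<Sum>j\<in>J. (M i j)\<^sup>2) ^ 3
    \<le> (\<Sum>i<m. \<Sum>l\<in>L. (u i l)\<^sup>2) * (\<Sum>l\<in>L. \<Sum>j\<in>J. (v l j)\<^sup>2)
        * (\<Sum>j\<in>J. \<Sum>j'\<in>J. (\<Sum>i<m. M i j * M i j')\<^sup>2)"
    (is "?f ^ 3 \<le> ?U * ?V * ?S")
proof (cases "?f = 0")
  case True
  have "0 \<le> ?U * ?V * ?S"
    by (intro mult_nonneg_nonneg sum_nonneg) auto
  with True show ?thesis
    by simp
next
  case False
  have "?f \<ge> 0"
    by (intro sum_nonneg) auto
  with False have f: "?f > 0"
    by simp
  \<comment> \<open>The diagonal terms \<open>j = j'\<close> of \<open>?S\<close> are the squares of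
    the squared column norms, so they all vanish only if \<open>M\<close> does.\<close>
  have "?S \<noteq> 0"
  proof
    assume "?S = 0"
    then have "\<forall>j\<in>J. (\<Sum>i<m. M i j * M i j) = 0"
      using fin by (simp add: sum_nonneg_eq_0_iff sum_nonneg)
    then have "(\<Sum>j\<in>J. \<Sum>i<m. (M i j)\<^sup>2) = 0"
      by (simp add: power2_eq_square)
    then show False
      using False by (subst (asm) sum.swap) simp
  qed
  moreover have "?S \<ge> 0"
    by (intro sum_nonneg) auto
  ultimately have S: "?S > 0"
    by simp
  define t where "t = ?S / ?f"
  have t: "t > 0"
    using f S by (simp add: t_def)
  have "\<exists>x. \<forall>i<m. (\<Sum>j'\<in>J. M i j' * (\<Sum>k<m. M k j' * x k)) + t * x i = M i j" for j
    by (rule regularized_solution[OF t, of m M J "\<lambda>i. M i j"]) blast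
  then have "\<exists>X. \<forall>j. \<forall>i<m. (\<Sum>j'\<in>J. M i j' * (\<Sum>k<m. M k j' * X j k)) + t * X j i = M i j"
    by (intro choice allI)
  then obtain X where X: "(\<Sum>j'\<in>J. M i j' * (\<Sum>k<m. M k j' * X j k)) + t * X j i = M i j" if "i < m" for i j
    by blast
  \<comment> \<open>\<open>X j\<close> is column \<open>j\<close> of \<open>Q\<close>, and
    \<open>q\<close> is the entrywise pairing of \<open>Q\<close> with \<open>M\<close>.\<close>
  define q where "q = (\<Sum>j\<in>J. \<Sum>i<m. X j i * M i j)"
  \<comment> \<open>The maximizer of \<open>2 * s * ?f - s^2 * (?S + t * ?f)\<close>, the lower
    bound for \<open>q\<close> derived below; note \<open>t * ?f = ?S\<close>.\<close>
  define s where "s = ?f / (2 * ?S)"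
  have form: "(\<Sum>i<m. y i * M i j) =
      (\<Sum>j'\<in>J. (\<Sum>i<m. M i j' * y i) * (\<Sum>i<m. M i j' * X j i)) + t * (\<Sum>i<m. y i * X j i)" for y j
  proof -
    have "(\<Sum>i<m. y i * M i j) =
        (\<Sum>i<m. y i * ((\<Sum>j'\<in>J. M i j' * (\<Sum>k<m. M k j' * X j k)) + t * X j i))"
      by (simp add: X)
    also have "\<dots> = (\<Sum>i<m. y i * (\<Sum>j'\<in>J. M i j' * (\<Sum>k<m. M k j' * X j k)))
        + t * (\<Sum>i<m. y i * X j i)"
      by (simp add: distrib_left sum.distrib sum_distrib_left mult_ac)
    finally show ?thesis
      by (simp add: gram_form)
  qed
  \<comment> \<open>Let \<open>A = M M^T + t I\<close> and let \<open>M_j\<close> be column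
    \<open>j\<close> of \<open>M\<close>, so that \<open>A\<close> maps \<open>X j\<close> to
    \<open>M_j\<close>. The inequality says that the quadratic form of \<open>A\<close> is
    nonnegative at \<open>X j - s M_j\<close>.\<close>
  have col: "2 * s * (\<Sum>i<m. (M i j)\<^sup>2)
      - s\<^sup>2 * ((\<Sum>j'\<in>J. (\<Sum>i<m. M i j * M i j')\<^sup>2) + t * (\<Sum>i<m. (M i j)\<^sup>2))
      \<le> (\<Sum>i<m. X j i * M i j)" for j
  proof -
    define z where "z j' = (\<Sum>i<m. M i j' * M i j)" for j'
    define y where "y j' = (\<Sum>i<m. M i j' * X j i)" for j'
    have 1: "(\<Sum>i<m. X j i * M i j) = (\<Sum>j'\<in>J. (y j')\<^sup>2) + t * (\<Sum>i<m. (X j i)\<^sup>2)"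
      unfolding form[of "X j" j] y_def power2_eq_square ..
    have 2: "(\<Sum>i<m. (M i j)\<^sup>2) = (\<Sum>j'\<in>J. z j' * y j') + t * (\<Sum>i<m. M i j * X j i)"
      using form[of "\<lambda>i. M i j" j] unfolding y_def z_def power2_eq_square .
    have 3: "2 * s * (\<Sum>i<m. (M i j)\<^sup>2)
        = 2 * s * (\<Sum>j'\<in>J. z j' * y j') + t * (2 * s * (\<Sum>i<m. M i j * X j i))"
      unfolding 2 by (simp add: distrib_left mult_ac)
    have "0 \<le> (\<Sum>j'\<in>J. (y j' - s * z j')\<^sup>2) + t * (\<Sum>i<m. (X j i - s * M i j)\<^sup>2)"
      using t by (intro add_nonneg_nonneg mult_nonneg_nonneg sum_nonneg) auto
    also have "(\<Sum>j'\<in>J. (y j' - s * z j')\<^sup>2)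
        = (\<Sum>j'\<in>J. (y j')\<^sup>2) - 2 * s * (\<Sum>j'\<in>J. z j' * y j') + s\<^sup>2 * (\<Sum>j'\<in>J. (z j')\<^sup>2)"
      by (simp add: power2_diff sum.distrib sum_subtractf sum_distrib_left power_mult_distrib mult_ac)
    also have "(\<Sum>i<m. (X j i - s * M i j)\<^sup>2)
        = (\<Sum>i<m. (X j i)\<^sup>2) - 2 * s * (\<Sum>i<m. M i j * X j i) + s\<^sup>2 * (\<Sum>i<m. (M i j)\<^sup>2)"
      by (simp add: power2_diff sum.distrib sum_subtractf sum_distrib_left power_mult_distrib mult_ac)
    finally have "0 \<le> (\<Sum>i<m. X j i * M i j) - 2 * s * (\<Sum>i<m. (M i j)\<^sup>2)
        + s\<^sup>2 * ((\<Sum>j'\<in>J. (z j')\<^sup>2) + t * (\<Sum>i<m. (M i j)\<^sup>2))"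
      unfolding 1 using 3 by (simp add: algebra_simps)
    then show ?thesis
      unfolding z_def by (simp add: mult.commute)
  qed
  have f_swap: "?f = (\<Sum>j\<in>J. \<Sum>i<m. (M i j)\<^sup>2)"
    by (rule sum.swap)
  have "2 * s * ?f - s\<^sup>2 * (?S + t * ?f) = (\<Sum>j\<in>J. 2 * s * (\<Sum>i<m. (M i j)\<^sup>2)
      - s\<^sup>2 * ((\<Sum>j'\<in>J. (\<Sum>i<m. M i j * M i j')\<^sup>2) + t * (\<Sum>i<m. (M i j)\<^sup>2)))"
    unfolding f_swap sum_subtractf sum.distrib sum_distrib_left[symmetric] ..
  also have "\<dots> \<le> q"
    unfolding q_def by (intro sum_mono col)
  finally have "2 * s * ?f - s\<^sup>2 * (?S + t * ?f) \<le> q" .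
  moreover have "2 * s * ?f - s\<^sup>2 * (?S + t * ?f) = ?f\<^sup>2 / (2 * ?S)"
    using f S by (simp add: s_def t_def power2_eq_square field_simps)
  ultimately have q: "?f\<^sup>2 / (2 * ?S) \<le> q"
    by simp
  define w where "w i l = (\<Sum>j\<in>J. X j i * v l j)" for i l
  \<comment> \<open>The operator norm bound for \<open>Q\<close>, applied to row \<open>l\<close> of
    \<open>v\<close>. With \<open>y = M^T w\<close> one gets
    \<open>t |w|^2 = <y, v> - |y|^2\<close>, and completing the square bounds this by
    \<open>|v|^2 / 4\<close>.\<close>
  have w: "4 * t * (\<Sum>i<m. (w i l)\<^sup>2) \<le> (\<Sum>j\<in>J. (v l j)\<^sup>2)" for l
  proof -
    define y where "y j' = (\<Sum>i<m. M i j' * w i l)" for j'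
    have y: "y j' = (\<Sum>j\<in>J. (\<Sum>i<m. M i j' * X j i) * v l j)" for j'
      unfolding y_def w_def sum_distrib_left sum_distrib_right
      by (subst sum.swap) (simp add: mult_ac)
    have "(\<Sum>j\<in>J. y j * v l j) = (\<Sum>j\<in>J. (\<Sum>i<m. w i l * M i j) * v l j)"
      by (simp add: y_def mult_ac)
    also have "\<dots> = (\<Sum>j\<in>J. \<Sum>j'\<in>J. y j' * ((\<Sum>i<m. M i j' * X j i) * v l j))
        + t * (\<Sum>j\<in>J. (\<Sum>i<m. w i l * X j i) * v l j)"
      unfolding form y_def[symmetric] distrib_right sum.distrib
      by (simp add: sum_distrib_right sum_distrib_left mult_ac)
    also have "(\<Sum>j\<in>J. \<Sum>j'\<in>J. y j' * ((\<Sum>i<m. M i j' * X j i) * v l j)) = (\<Sum>j\<in>J. (y j)\<^sup>2)"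
      by (subst sum.swap) (simp add: power2_eq_square y flip: sum_distrib_left)
    also have "(\<Sum>j\<in>J. (\<Sum>i<m. w i l * X j i) * v l j) = (\<Sum>i<m. (w i l)\<^sup>2)"
      unfolding sum_distrib_right
      by (subst sum.swap) (simp add: power2_eq_square w_def mult.assoc flip: sum_distrib_left)
    finally have "t * (\<Sum>i<m. (w i l)\<^sup>2) = (\<Sum>j\<in>J. y j * v l j - (y j)\<^sup>2)"
      by (simp add: sum_subtractf)
    also have "\<dots> \<le> (\<Sum>j\<in>J. (v l j)\<^sup>2 / 4)"
    proof (rule sum_mono)
      fix j
      have "0 \<le> (y j - v l j / 2)\<^sup>2"
        by simp
      then show "y j * v l j - (y j)\<^sup>2 \<le> (v l j)\<^sup>2 / 4"
        by (simp add: power2_diff power_divide)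
    qed
    finally show ?thesis
      by (simp flip: sum_divide_distrib)
  qed
  \<comment> \<open>Inserting the factorization of \<open>M\<close> turns \<open>q\<close> into the
    pairing of \<open>u\<close> with \<open>w\<close>, ready for Cauchy-Schwarz over all index pairs
    \<open>(i, l)\<close>.\<close>
  have "q = (\<Sum>j\<in>J. \<Sum>i<m. \<Sum>l\<in>L. u i l * (X j i * v l j))"
    unfolding q_def by (intro sum.cong refl) (simp add: fac sum_distrib_left mult_ac)
  also have "\<dots> = (\<Sum>i<m. \<Sum>l\<in>L. u i l * w i l)"
    unfolding w_def sum_distrib_left
    by (subst sum.swap) (intro sum.cong refl, rule sum.swap)
  also have "\<dots> = (\<Sum>(i, l)\<in>{..<m} \<times> L. u i l * w i l)"
    by (rule sum.cartesian_product)
  finally have "q = (\<Sum>p\<in>{..<m} \<times> L. u (fst p) (snd p) * w (fst p) (snd p))"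
    by (simp add: case_prod_unfold)
  then have "q\<^sup>2 \<le> (\<Sum>p\<in>{..<m} \<times> L. (u (fst p) (snd p))\<^sup>2) * (\<Sum>p\<in>{..<m} \<times> L. (w (fst p) (snd p))\<^sup>2)"
    by (simp add: Cauchy_Schwarz_ineq_sum)
  also have "(\<Sum>p\<in>{..<m} \<times> L. (u (fst p) (snd p))\<^sup>2) = ?U"
    by (simp add: sum.cartesian_product case_prod_unfold)
  also have "(\<Sum>p\<in>{..<m} \<times> L. (w (fst p) (snd p))\<^sup>2) = (\<Sum>l\<in>L. \<Sum>i<m. (w i l)\<^sup>2)"
    by (subst sum.swap) (simp add: sum.cartesian_product case_prod_unfold)
  finally have q2: "q\<^sup>2 \<le> ?U * (\<Sum>l\<in>L. \<Sum>i<m. (w i l)\<^sup>2)" .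
  have U: "?U \<ge> 0"
    by (intro sum_nonneg) auto
  have "4 * t * (\<Sum>l\<in>L. \<Sum>i<m. (w i l)\<^sup>2) \<le> ?V"
    by (subst sum_distrib_left) (intro sum_mono w)
  then have UV: "?U * (4 * t * (\<Sum>l\<in>L. \<Sum>i<m. (w i l)\<^sup>2)) \<le> ?U * ?V"
    using U by (rule mult_left_mono)
  have "?f ^ 3 / ?S = 4 * t * (?f\<^sup>2 / (2 * ?S))\<^sup>2"
    using f S by (simp add: t_def power2_eq_square power3_eq_cube field_simps)
  also have "\<dots> \<le> 4 * t * q\<^sup>2"
    using q f S t by (intro mult_left_mono power_mono) auto
  also have "\<dots> \<le> 4 * t * (?U * (\<Sum>l\<in>L. \<Sum>i<m. (w i l)\<^sup>2))"
    using q2 t by (intro mult_left_mono) auto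
  also have "\<dots> \<le> ?U * ?V"
    using UV by (simp add: mult_ac)
  finally show ?thesis
    using S by (simp add: field_simps)
qed

section \<open>From factorizations to \<open>gamma2\<close> and incidence counts\<close>

lemma L2_set_le_row_norm:
  "i < dim_row U \<Longrightarrow> L2_set (\<lambda>j. cmod (U $$ (i, j))) {..<dim_col U} \<le> row_norm U"
  unfolding row_norm_def by (intro Max_ge) auto

lemma L2_set_le_col_norm:
  "j < dim_col V \<Longrightarrow> L2_set (\<lambda>i. cmod (V $$ (i, j))) {..<dim_row V} \<le> col_norm V"
  unfolding col_norm_def by (intro Max_ge) auto

lemma row_norm_nonneg: "row_norm U \<ge> 0"
  unfolding row_norm_def by (intro Max_ge) auto

lemma col_norm_nonneg: "col_norm V \<ge> 0"
  unfolding col_norm_def by (intro Max_ge) auto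

lemma sum_le_of_L2_set_le:
  assumes "L2_set f A \<le> r"
  shows "(\<Sum>a\<in>A. (f a)\<^sup>2) \<le> r\<^sup>2"
  using assms unfolding L2_set_def by (rule sqrt_le_D)

text \<open>Summing over \<open>m\<close> rows of \<open>U\<close> and \<open>n\<close> columns of
  \<open>V\<close> bounds the squared Frobenius norms by \<open>m\<close> and \<open>n\<close> times
  the squared row and column norms. The majorant \<open>D\<close> lets estimates replace exact
  counts.\<close>

lemma gamma2_lower_bound:
  fixes N :: "nat \<Rightarrow> nat \<Rightarrow> real"
  assumes le: "real m * real n * (\<Sum>j<n. \<Sum>j'<n. (\<Sum>i<m. N i j * N i j')\<^sup>2) \<le> D" and D: "D > 0"
  shows "sqrt ((\<Sum>i<m. \<Sum>j<n. (N i j)\<^sup>2) ^ 3 / D) \<le> gamma2 (mat m n (\<lambda>(i, j). of_real (N i j)))"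
  unfolding gamma2_def
proof (rule cInf_greatest[OF gamma2_values_nonempty])
  let ?M = "mat m n (\<lambda>(i, j). of_real (N i j)) :: complex mat"
  let ?f = "\<Sum>i<m. \<Sum>j<n. (N i j)\<^sup>2" and ?S = "\<Sum>j<n. \<Sum>j'<n. (\<Sum>i<m. N i j * N i j')\<^sup>2"
  fix x
  assume "x \<in> gamma2_values ?M"
  then obtain U V k where x: "x = row_norm U * col_norm V"
    and U: "U \<in> carrier_mat m k" and V: "V \<in> carrier_mat k n" and M: "?M = U * V"
    unfolding gamma2_values_def by auto
  \<comment> \<open>Since \<open>N\<close> is real, the real part of \<open>U V\<close> gives a real factorization with the same norms and
    twice the inner dimension.\<close>
  define L where "L = (UNIV :: bool set) \<times> {..<k}"
  define u where "u i p = (if fst p then Re (U $$ (i, snd p)) else - Im (U $$ (i, snd p)))"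
    for i :: nat and p :: "bool \<times> nat"
  define v where "v p j = (if fst p then Re (V $$ (snd p, j)) else Im (V $$ (snd p, j)))"
    for j :: nat and p :: "bool \<times> nat"
  have L: "(\<Sum>p\<in>L. F p) = (\<Sum>l<k. F (True, l) + F (False, l))" for F :: "bool \<times> nat \<Rightarrow> real"
  proof -
    have "(\<Sum>p\<in>L. F p) = (\<Sum>b\<in>UNIV. \<Sum>l<k. F (b, l))"
      by (simp add: L_def sum.cartesian_product)
    then show ?thesis
      by (simp add: UNIV_bool sum.distrib add.commute)
  qed
  have "N i j = (\<Sum>p\<in>L. u i p * v p j)" if "i < m" "j < n" for i j
  proof -
    have "complex_of_real (N i j) = (U * V) $$ (i, j)"
      using that by (simp flip: M)
    also have "\<dots> = (\<Sum>l<k. U $$ (i, l) * V $$ (l, j))"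
      using U V that by (simp add: scalar_prod_def atLeast0LessThan)
    finally have "N i j = Re (\<Sum>l<k. U $$ (i, l) * V $$ (l, j))"
      by (metis Re_complex_of_real)
    then show ?thesis
      unfolding L by (simp add: u_def v_def)
  qed
  then have "?f ^ 3 \<le> (\<Sum>i<m. \<Sum>p\<in>L. (u i p)\<^sup>2) * (\<Sum>p\<in>L. \<Sum>j<n. (v p j)\<^sup>2) * ?S"
    by (intro factorization_lower_bound) auto
  also have "\<dots> \<le> (real m * (row_norm U)\<^sup>2) * (real n * (col_norm V)\<^sup>2) * ?S"
  proof (intro mult_right_mono mult_mono)
    have "(\<Sum>p\<in>L. (u i p)\<^sup>2) \<le> (row_norm U)\<^sup>2" if "i < m" for i
      using sum_le_of_L2_set_le[OF L2_set_le_row_norm[of i U]] that U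
      unfolding L by (simp add: u_def cmod_power2)
    then show "(\<Sum>i<m. \<Sum>p\<in>L. (u i p)\<^sup>2) \<le> real m * (row_norm U)\<^sup>2"
      using sum_bounded_above[of "{..<m}" "\<lambda>i. \<Sum>p\<in>L. (u i p)\<^sup>2"] by simp
    have "(\<Sum>p\<in>L. (v p j)\<^sup>2) \<le> (col_norm V)\<^sup>2" if "j < n" for j
      using sum_le_of_L2_set_le[OF L2_set_le_col_norm[of j V]] that V
      unfolding L by (simp add: v_def cmod_power2)
    then show "(\<Sum>p\<in>L. \<Sum>j<n. (v p j)\<^sup>2) \<le> real n * (col_norm V)\<^sup>2"
      using sum_bounded_above[of "{..<n}" "\<lambda>j. \<Sum>p\<in>L. (v p j)\<^sup>2"]
      by (subst sum.swap) simp
  qed (auto intro!: sum_nonneg mult_nonneg_nonneg)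
  also have "\<dots> = x\<^sup>2 * (real m * real n * ?S)"
    by (simp add: x power_mult_distrib mult_ac)
  also have "\<dots> \<le> x\<^sup>2 * D"
    using le by (intro mult_left_mono) auto
  finally have "?f ^ 3 / D \<le> x\<^sup>2"
    using D by (simp add: field_simps)
  moreover have "x \<ge> 0"
    by (simp add: x row_norm_nonneg col_norm_nonneg)
  ultimately show "sqrt (?f ^ 3 / D) \<le> x"
    by (simp add: real_le_lsqrt)
qed

text \<open>A Gram entry of a 0/1 matrix counts the members of \<open>H\<close> through two given
  points. Its square counts ordered pairs of them, so the sum over pairs of points counts the
  quadruples \<open>(h, h', p, p')\<close>.\<close>

lemma incidence_gamma2_lower_bound:
  assumes ps: "distinct ps" "set ps = P" and hs: "distinct hs" "set hs = H"
    and le: "real (card H) * real (card P)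
      * real (card {(h, h', p, p'). h \<in> H \<and> h' \<in> H \<and> p \<in> P \<inter> h \<inter> h' \<and> p' \<in> P \<inter> h \<inter> h'}) \<le> D"
    and D: "D > 0"
  shows "sqrt (real (card {(h, p). h \<in> H \<and> p \<in> P \<inter> h}) ^ 3 / D) \<le> gamma2 (incidence_mat hs ps)"
proof -
  have fin: "finite P" "finite H"
    using ps hs by auto
  define N :: "nat \<Rightarrow> nat \<Rightarrow> real" where "N i j = of_bool (ps ! j \<in> hs ! i)" for i j
  have sum_ps: "(\<Sum>j<length ps. F (ps ! j)) = (\<Sum>p\<in>P. F p)" for F :: "'a \<Rightarrow> real"
    using ps by (intro sum.reindex_bij_betw bij_betw_nth) auto
  have sum_hs: "(\<Sum>i<length hs. F (hs ! i)) = (\<Sum>h\<in>H. F h)" for F :: "'a set \<Rightarrow> real"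
    using hs by (intro sum.reindex_bij_betw bij_betw_nth) auto
  have "(\<Sum>i<length hs. \<Sum>j<length ps. (N i j)\<^sup>2) = (\<Sum>h\<in>H. \<Sum>p\<in>P. of_bool (p \<in> h))"
  proof -
    have "(N i j)\<^sup>2 = of_bool (ps ! j \<in> hs ! i)" for i j
      by (auto simp: N_def)
    then show ?thesis
      by (simp only: sum_ps[of "\<lambda>p. of_bool (p \<in> h)" for h] sum_hs[of "\<lambda>h. \<Sum>p\<in>P. of_bool (p \<in> h)"])
  qed
  also have "\<dots> = (\<Sum>x\<in>H \<times> P. of_bool (snd x \<in> fst x))"
    by (simp add: sum.cartesian_product case_prod_unfold)
  also have "\<dots> = real (card ((H \<times> P) \<inter> {x. snd x \<in> fst x}))"
    using fin by (simp add: sum_of_bool_eq)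
  also have "(H \<times> P) \<inter> {x. snd x \<in> fst x} = {(h, p). h \<in> H \<and> p \<in> P \<inter> h}"
    by auto
  finally have f: "(\<Sum>i<length hs. \<Sum>j<length ps. (N i j)\<^sup>2) = real (card {(h, p). h \<in> H \<and> p \<in> P \<inter> h})" .
  define G where "G p p' = (\<Sum>h\<in>H. of_bool (p \<in> h) * of_bool (p' \<in> h) :: real)" for p p'
  have "(\<Sum>j<length ps. \<Sum>j'<length ps. (\<Sum>i<length hs. N i j * N i j')\<^sup>2)
      = (\<Sum>j<length ps. \<Sum>j'<length ps. (G (ps ! j) (ps ! j'))\<^sup>2)"
    unfolding N_def G_def by (intro sum.cong refl arg_cong[where f = "\<lambda>x. x\<^sup>2"]) (rule sum_hs)
  also have "\<dots> = (\<Sum>p\<in>P. \<Sum>p'\<in>P. (G p p')\<^sup>2)"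
    by (simp only: sum_ps[of "\<lambda>p'. (G p p')\<^sup>2" for p] sum_ps[of "\<lambda>p. \<Sum>p'\<in>P. (G p p')\<^sup>2"])
  also have "\<dots> = (\<Sum>p\<in>P. \<Sum>p'\<in>P. \<Sum>h\<in>H. \<Sum>h'\<in>H.
      of_bool (p \<in> h \<and> p' \<in> h \<and> p \<in> h' \<and> p' \<in> h'))"
    unfolding G_def power2_eq_square sum_product by (intro sum.cong refl) auto
  also have "\<dots> = (\<Sum>h\<in>H. \<Sum>h'\<in>H. \<Sum>p\<in>P. \<Sum>p'\<in>P.
      of_bool (p \<in> h \<and> p' \<in> h \<and> p \<in> h' \<and> p' \<in> h'))"
    unfolding sum.cartesian_product
    by (rule sum.reindex_bij_witness[of _ "\<lambda>(h, h', p, p'). (p, p', h, h')" "\<lambda>(p, p', h, h'). (h, h', p, p')"])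
      auto
  also have "\<dots> = (\<Sum>x\<in>H \<times> H \<times> P \<times> P.
      of_bool (case x of (h, h', p, p') \<Rightarrow> p \<in> h \<and> p' \<in> h \<and> p \<in> h' \<and> p' \<in> h'))"
    by (simp add: sum.cartesian_product case_prod_unfold)
  also have "\<dots> = real (card ((H \<times> H \<times> P \<times> P)
      \<inter> {(h, h', p, p'). p \<in> h \<and> p' \<in> h \<and> p \<in> h' \<and> p' \<in> h'}))"
    using fin by (simp add: sum_of_bool_eq)
  also have "(H \<times> H \<times> P \<times> P) \<inter> {(h, h', p, p'). p \<in> h \<and> p' \<in> h \<and> p \<in> h' \<and> p' \<in> h'}
      = {(h, h', p, p'). h \<in> H \<and> h' \<in> H \<and> p \<in> P \<inter> h \<inter> h' \<and> p' \<in> P \<inter> h \<inter> h'}"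
    by auto
  finally have S: "(\<Sum>j<length ps. \<Sum>j'<length ps. (\<Sum>i<length hs. N i j * N i j')\<^sup>2)
      = real (card {(h, h', p, p'). h \<in> H \<and> h' \<in> H \<and> p \<in> P \<inter> h \<inter> h' \<and> p' \<in> P \<inter> h \<inter> h'})" .
  have "incidence_mat hs ps = mat (length hs) (length ps) (\<lambda>(i, j). of_real (N i j))"
    by (auto simp: incidence_mat_def N_def intro!: cong_mat)
  moreover have "length ps = card P" "length hs = card H"
    using ps hs distinct_card by metis+
  ultimately show ?thesis
    using gamma2_lower_bound[of "length hs" "length ps" N D] le D f S by simp
qed

section \<open>Integer solutions of a bilinear equation\<close>

text \<open>Dividing \<open>(a, b)\<close> by its gcd leaves a primitive vector
  \<open>(p, q)\<close>, and the integer vectors orthogonal to it are the multiples of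
  \<open>(q, - p)\<close>. If \<open>a = b = 0\<close>, a nonzero \<open>(u, v)\<close> supplies the
  direction instead.\<close>

lemma int_orthogonal_parametrization:
  fixes a b u v :: int
  assumes "a * u + b * v = 0"
  obtains p q g t where "(p, q) \<noteq> (0, 0)" "a = g * p" "b = g * q" "u = t * q" "v = - (t * p)"
proof (cases "a = 0 \<and> b = 0")
  case True
  show thesis
  proof (cases "u = 0 \<and> v = 0")
    case True
    with \<open>a = 0 \<and> b = 0\<close> show thesis
      by (intro that[of 1 0 0 0]) auto
  next
    case False
    with \<open>a = 0 \<and> b = 0\<close> show thesis
      by (intro that[of "- v" u 0 1]) auto
  qed
next
  case False
  define g where "g = gcd a b"
  obtain p q where pq: "a = g * p" "b = g * q" "coprime p q"
    using False gcd_coprime_exists[of a b] unfolding g_def by (metis gcd_eq_0_iff mult.commute)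
  have "g \<noteq> 0"
    using False by (simp add: g_def)
  have "g * (p * u + q * v) = 0"
    using assms pq by (simp add: algebra_simps)
  then have eq: "p * u = - (q * v)"
    using \<open>g \<noteq> 0\<close> by simp
  then have "q dvd p * u"
    by simp
  then have "q dvd u"
    using pq(3) by (simp add: coprime_commute coprime_dvd_mult_right_iff)
  then obtain t where t: "u = t * q"
    by (metis dvd_def mult.commute)
  show thesis
  \<comment> \<open>For \<open>q = 0\<close> the equation \<open>u = t * q\<close> does not
    determine the multiplier; it is read off from \<open>v\<close>, using
    \<open>p * p = 1\<close>.\<close>
  proof (cases "q = 0")
    case True
    then have "\<bar>p\<bar> = 1"
      using pq(3) by simp
    then have "v = - ((- v * p) * p)"
      by (simp add: abs_if split: if_splits)
    with True show thesis
      using pq t \<open>\<bar>p\<bar> = 1\<close> by (intro that[of p q g "- v * p"]) auto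
  next
    case False
    have "q * (v + t * p) = 0"
      using eq t by (simp add: algebra_simps)
    with False have "v = - (t * p)"
      by simp
    with False show thesis
      using pq t by (intro that[of p q g t]) auto
  qed
qed

text \<open>\<open>(a, b)\<close> stands for a difference of slopes of two planes and
  \<open>(u, v)\<close> for a difference of two base points; differences of numbers in
  \<open>{0..<X}\<close> are below \<open>X\<close> in absolute value.\<close>

definition orthogonal_pairs :: "nat \<Rightarrow> (int \<times> int \<times> int \<times> int) set" where
  "orthogonal_pairs X = {(a, b, u, v). \<bar>a\<bar> < int X \<and> \<bar>b\<bar> < int X \<and> \<bar>u\<bar> < int X \<and> \<bar>v\<bar> < int X
     \<and> a * u + b * v = 0}"

text \<open>Every solution has the form \<open>(g p, g q, t q, - t p)\<close>. For \<open>s = max \<bar>p\<bar> \<bar>q\<bar>\<close> there are \<open>O(s)\<close>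
  choices of \<open>(p, q)\<close> and \<open>O(X / s)\<close> choices of each of \<open>g\<close> and \<open>t\<close>.\<close>

lemma card_orthogonal_pairs:
  assumes "X \<ge> 1"
  shows "real (card (orthogonal_pairs X)) \<le> 108 * real X ^ 2 * harm X"
    and "finite (orthogonal_pairs X)"
proof -
  \<comment> \<open>\<open>B s\<close> is the boundary of the square
    \<open>max |p| |q| \<le> s\<close>, given by its four sides; \<open>K s\<close> holds the
    multipliers \<open>g\<close> with \<open>|g| * s \<le> X\<close>.\<close>
  define B where "B s = (let I = {- int s..int s}; E = {- int s, int s} in (I \<times> E) \<union> (E \<times> I))" for s :: nat
  define K where "K s = {- int (X div s)..int (X div s)}" for s :: nat
  define W where "W = (\<Union>s\<in>{1..X}. B s \<times> K s \<times> K s)"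
  have fin: "finite (B s \<times> K s \<times> K s)" for s
    by (simp add: B_def K_def Let_def)
  then have finW: "finite W"
    by (simp add: W_def)
  have sub: "orthogonal_pairs X \<subseteq> (\<lambda>((p, q), g, t). (g * p, g * q, t * q, - (t * p))) ` W"
  proof
    fix z
    assume "z \<in> orthogonal_pairs X"
    then obtain a b u v where z: "z = (a, b, u, v)" "a * u + b * v = 0"
      and less: "\<bar>a\<bar> < int X" "\<bar>b\<bar> < int X" "\<bar>u\<bar> < int X" "\<bar>v\<bar> < int X"
      by (auto simp: orthogonal_pairs_def)
    \<comment> \<open>A nonzero multiplier bounds \<open>p\<close> and \<open>q\<close> by
      \<open>X\<close>. With \<open>g = t = 0\<close> nothing would bound them, so the zero solution
      is given the direction \<open>(1, 0)\<close>.\<close>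
    have "\<exists>p q g t. (p, q) \<noteq> (0, 0) \<and> a = g * p \<and> b = g * q \<and> u = t * q \<and> v = - (t * p)
        \<and> max \<bar>p\<bar> \<bar>q\<bar> \<le> int X"
    proof (cases "a = 0 \<and> b = 0 \<and> u = 0 \<and> v = 0")
      case True
      then show ?thesis
        using assms by (intro exI[of _ 1] exI[of _ 0]) auto
    next
      case False
      obtain p q g t where *: "(p, q) \<noteq> (0, 0)" "a = g * p" "b = g * q" "u = t * q" "v = - (t * p)"
        using int_orthogonal_parametrization[OF z(2)] by blast
      have le: "\<bar>r\<bar> \<le> int X" if "\<bar>c * r\<bar> < int X" "c \<noteq> 0" for c r :: int
      proof -
        have "1 * \<bar>r\<bar> \<le> \<bar>c\<bar> * \<bar>r\<bar>"
          using that(2) by (intro mult_right_mono) auto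
        then show ?thesis
          using that(1) by (simp add: abs_mult)
      qed
      have "g \<noteq> 0 \<or> t \<noteq> 0"
        using False * by auto
      then have "max \<bar>p\<bar> \<bar>q\<bar> \<le> int X"
        using le[of g p] le[of g q] le[of t p] le[of t q] less * by auto
      then show ?thesis
        using * by blast
    qed
    then obtain p q g t where *: "(p, q) \<noteq> (0, 0)" "a = g * p" "b = g * q" "u = t * q" "v = - (t * p)"
        "max \<bar>p\<bar> \<bar>q\<bar> \<le> int X"
      by blast
    define s where "s = nat (max \<bar>p\<bar> \<bar>q\<bar>)"
    have s: "int s = max \<bar>p\<bar> \<bar>q\<bar>"
      by (simp add: s_def)
    have s1: "s \<ge> 1" "s \<le> X"
      using * s by auto
    have "\<bar>g * p\<bar> \<le> int X" "\<bar>g * q\<bar> \<le> int X" "\<bar>t * p\<bar> \<le> int X" "\<bar>t * q\<bar> \<le> int X"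
      using less * by auto
    then have "\<bar>g\<bar> * int s \<le> int X" "\<bar>t\<bar> * int s \<le> int X"
      by (auto simp: s abs_mult max_def)
    moreover have "c \<le> int (X div s)" if "c * int s \<le> int X" for c
      using zdiv_mono1[OF that, of "int s"] s1 by (simp add: zdiv_int)
    ultimately have "\<bar>g\<bar> \<le> int (X div s)" "\<bar>t\<bar> \<le> int (X div s)"
      by blast+
    then have "g \<in> K s" "t \<in> K s"
      by (auto simp: K_def)
    moreover have "(p, q) \<in> B s"
    proof (cases "\<bar>p\<bar> \<le> \<bar>q\<bar>")
      case True
      then have "p \<in> {- int s..int s}" "q \<in> {- int s, int s}"
        using s by auto
      then show ?thesis
        by (simp add: B_def Let_def)
    next
      case False
      then have "q \<in> {- int s..int s}" "p \<in> {- int s, int s}"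
        using s by auto
      then show ?thesis
        by (simp add: B_def Let_def)
    qed
    ultimately have "((p, q), g, t) \<in> W"
      using s1 by (auto simp: W_def)
    then show "z \<in> (\<lambda>((p, q), g, t). (g * p, g * q, t * q, - (t * p))) ` W"
      using z * by (intro image_eqI[of _ _ "((p, q), g, t)"]) auto
  qed
  show "finite (orthogonal_pairs X)"
    using sub finW finite_surj by blast
  have "real (card (orthogonal_pairs X)) \<le> real (card W)"
    using sub finW by (simp add: surj_card_le)
  also have "\<dots> \<le> real (\<Sum>s\<in>{1..X}. card (B s \<times> K s \<times> K s))"
    unfolding W_def of_nat_le_iff by (rule card_UN_le) simp
  also have "\<dots> \<le> (\<Sum>s\<in>{1..X}. 108 * real X ^ 2 * inverse (real s))"
    unfolding of_nat_sum
  proof (rule sum_mono)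
    fix s
    assume s: "s \<in> {1..X}"
    \<comment> \<open>As \<open>r \<ge> 1\<close>, the size \<open>2 * (X div s) + 1\<close> of
      \<open>K s\<close> is at most \<open>3 * r\<close>. With at most \<open>12 * s\<close>
      elements in \<open>B s\<close> this yields \<open>108 = 12 * 3^2\<close>.\<close>
    define r where "r = real X / real s"
    have r: "1 \<le> r"
      using s by (simp add: r_def)
    have "card {- int s..int s} = 2 * s + 1" "card {- int s, int s} = 2"
      using s by (auto simp: nat_add_distrib nat_mult_distrib)
    then have "card (B s) \<le> (2 * s + 1) * 2 + 2 * (2 * s + 1)"
      unfolding B_def Let_def
      by (intro order_trans[OF card_Un_le]) (simp only: card_cartesian_product order_refl)
    then have B: "card (B s) \<le> 12 * s"
      using s by simp
    have "real (X div s) \<le> r"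
      by (simp add: r_def of_nat_div_le_of_nat)
    then have K: "real (card (K s)) \<le> 3 * r"
      using r by (simp add: K_def)
    have "real (card (B s \<times> K s \<times> K s)) = real (card (B s)) * (real (card (K s)) * real (card (K s)))"
      by (simp add: card_cartesian_product)
    also have "\<dots> \<le> (12 * real s) * ((3 * r) * (3 * r))"
      using B K r by (intro mult_mono) auto
    also have "\<dots> = 108 * real X ^ 2 * inverse (real s)"
      using s by (simp add: r_def field_simps power2_eq_square)
    finally show "real (card (B s \<times> K s \<times> K s)) \<le> 108 * real X ^ 2 * inverse (real s)" .
  qed
  also have "\<dots> = 108 * real X ^ 2 * harm X"
    by (simp add: harm_def sum_distrib_left)
  finally show "real (card (orthogonal_pairs X)) \<le> 108 * real X ^ 2 * harm X" .
qed

text \<open>The difference \<open>harm X - ln X\<close> decreases from its value 1 at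
  \<open>X = 1\<close>, and this 1 is absorbed because
  \<open>ln n \<ge> ln 2 \<ge> 2/3\<close>.\<close>

lemma harm_le_ln:
  assumes "1 \<le> X" "X \<le> n" "2 \<le> n"
  shows "harm X \<le> 3 * ln (real n)"
proof -
  have "harm X - ln (real X) \<le> harm 1 - ln (real 1)"
    using assms euler_mascheroni_sequence_decreasing[of 1 X] by simp
  then have "harm X \<le> 1 + ln (real X)"
    by (simp add: harm_def)
  moreover have "ln (real X) \<le> ln (real n)" "ln 2 \<le> ln (real n)"
    using assms by simp_all
  ultimately show ?thesis
    using ln2_ge_two_thirds by linarith
qed

section \<open>The grid of points and planes\<close>

definition grid_point :: "int \<Rightarrow> int \<Rightarrow> int \<Rightarrow> real ^ 3" where
  "grid_point x y z = vector [of_int x, of_int y, of_int z]"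

definition grid_plane :: "int \<Rightarrow> int \<Rightarrow> int \<Rightarrow> (real ^ 3) set" where
  "grid_plane a b c = {p. p $ 3 = of_int a * p $ 1 + of_int b * p $ 2 + of_int c}"

lemma grid_point_in_grid_plane [simp]:
  "grid_point x y z \<in> grid_plane a b c \<longleftrightarrow> z = a * x + b * y + c"
  unfolding grid_point_def grid_plane_def
  by (simp flip: of_int_add of_int_mult)

lemma grid_point_inject [simp]:
  "grid_point x y z = grid_point x' y' z' \<longleftrightarrow> x = x' \<and> y = y' \<and> z = z'"
  unfolding grid_point_def by (metis of_int_eq_iff vector_3)

lemma grid_plane_inject [simp]:
  "grid_plane a b c = grid_plane a' b' c' \<longleftrightarrow> a = a' \<and> b = b' \<and> c = c'"
proof
  assume eq: "grid_plane a b c = grid_plane a' b' c'"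
  have "z = a * x + b * y + c \<longleftrightarrow> z = a' * x + b' * y + c'" for x y z
    using eq grid_point_in_grid_plane by metis
  \<comment> \<open>The points of the plane over \<open>(0, 0)\<close>, \<open>(1, 0)\<close> and
    \<open>(0, 1)\<close> determine its three coefficients.\<close>
  from this[of c 0 0] this[of "a + c" 1 0] this[of "b + c" 0 1]
  show "a = a' \<and> b = b' \<and> c = c'"
    by auto
qed auto

lemma hyperplane_grid_plane: "hyperplane (grid_plane a b c)"
  unfolding hyperplane_def
proof (intro exI conjI)
  let ?n = "vector [of_int a, of_int b, - 1] :: real ^ 3"
  have "?n $ 3 \<noteq> 0"
    by simp
  then show "?n \<noteq> 0"
    by (metis zero_index)
  show "grid_plane a b c = {x. ?n \<bullet> x = - of_int c}"
    by (auto simp: grid_plane_def inner_vec_def sum_3)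
qed

text \<open>The heights cover every \<open>a * x + b * y + c\<close> with grid parameters: both
  products are at most \<open>(X - 1)^2\<close>, and \<open>c < X^2\<close>.\<close>

definition grid_points :: "nat \<Rightarrow> (real ^ 3) set" where
  "grid_points X = (\<lambda>(x, y, z). grid_point x y z) `
     ({0..<int X} \<times> {0..<int X} \<times> {0..<int (X\<^sup>2) + 2 * (int X - 1)\<^sup>2})"

definition grid_planes :: "nat \<Rightarrow> (real ^ 3) set set" where
  "grid_planes X = (\<lambda>(a, b, c). grid_plane a b c) `
     ({0..<int X} \<times> {0..<int X} \<times> {0..<int (X\<^sup>2)})"

lemma finite_grid: "finite (grid_points X)" "finite (grid_planes X)"
  by (simp_all add: grid_points_def grid_planes_def)

lemma card_int_interval: "card {0..<int k} = k"
  by simp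

text \<open>Not rounded up to \<open>3 * X ^ 4\<close>: at \<open>X = 1\<close> the bound equals 1,
  so the grid fits even for \<open>n = 2\<close>.\<close>

lemma card_grid_points:
  assumes "X \<ge> 1"
  shows "card (grid_points X) \<le> X\<^sup>2 * (X\<^sup>2 + 2 * (X - 1)\<^sup>2)"
proof -
  have "card (grid_points X)
      \<le> card ({0..<int X} \<times> {0..<int X} \<times> {0..<int (X\<^sup>2) + 2 * (int X - 1)\<^sup>2})"
    unfolding grid_points_def by (intro card_image_le) auto
  also have "int (X\<^sup>2) + 2 * (int X - 1)\<^sup>2 = int (X\<^sup>2 + 2 * (X - 1)\<^sup>2)"
    using assms by (simp add: of_nat_diff)
  finally show ?thesis
    by (simp only: card_cartesian_product card_int_interval) (simp add: power2_eq_square)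
qed

lemma grid_points_size_le: "X\<^sup>2 * (X\<^sup>2 + 2 * (X - 1)\<^sup>2) \<le> 3 * X ^ 4" for X :: nat
proof -
  have "(X - 1)\<^sup>2 \<le> X\<^sup>2"
    by (simp add: power_mono)
  then have "X\<^sup>2 * (X\<^sup>2 + 2 * (X - 1)\<^sup>2) \<le> X\<^sup>2 * (3 * X\<^sup>2)"
    by (intro mult_left_mono) auto
  also have "\<dots> = 3 * X ^ 4"
    by (simp add: power2_eq_square power4_eq_xxxx)
  finally show ?thesis .
qed

lemma card_grid_planes: "card (grid_planes X) \<le> X ^ 4"
proof -
  have "card (grid_planes X) \<le> card ({0..<int X} \<times> {0..<int X} \<times> {0..<int (X\<^sup>2)})"
    unfolding grid_planes_def by (intro card_image_le) auto
  also have "\<dots> = X ^ 4"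
    by (simp only: card_cartesian_product card_int_interval)
      (simp add: power2_eq_square power4_eq_xxxx)
  finally show ?thesis .
qed

text \<open>Each of the \<open>X ^ 4\<close> planes has one point of the grid over each of the
  \<open>X^2\<close> base points \<open>(x, y)\<close>.\<close>

lemma card_grid_incidences:
  "X ^ 6 \<le> card {(h, p). h \<in> grid_planes X \<and> p \<in> grid_points X \<inter> h}"
proof -
  let ?G = "{0..<int X}" and ?C = "{0..<int (X\<^sup>2)}"
  let ?F = "\<lambda>(a, b, c, x, y). (grid_plane a b c, grid_point x y (a * x + b * y + c))"
  have "inj_on ?F (?G \<times> ?G \<times> ?C \<times> ?G \<times> ?G)"
    by (auto simp: inj_on_def)
  then have "card (?F ` (?G \<times> ?G \<times> ?C \<times> ?G \<times> ?G)) = card (?G \<times> ?G \<times> ?C \<times> ?G \<times> ?G)"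
    by (rule card_image)
  also have "\<dots> = X ^ 6"
    by (simp only: card_cartesian_product card_int_interval) (simp add: eval_nat_numeral)
  finally have "X ^ 6 = card (?F ` (?G \<times> ?G \<times> ?C \<times> ?G \<times> ?G))" ..
  also have "\<dots> \<le> card {(h, p). h \<in> grid_planes X \<and> p \<in> grid_points X \<inter> h}"
  proof (rule card_mono)
    have "{(h, p). h \<in> grid_planes X \<and> p \<in> grid_points X \<inter> h} \<subseteq> grid_planes X \<times> grid_points X"
      by auto
    then show "finite {(h, p). h \<in> grid_planes X \<and> p \<in> grid_points X \<inter> h}"
      using finite_grid finite_subset by blast
    have "grid_point x y (a * x + b * y + c) \<in> grid_points X"
      if "a \<in> ?G" "b \<in> ?G" "c \<in> ?C" "x \<in> ?G" "y \<in> ?G" for a b c x y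
    proof -
      have "a * x \<le> (int X - 1) * (int X - 1)" "b * y \<le> (int X - 1) * (int X - 1)"
        using that by (auto intro!: mult_mono)
      moreover have "0 \<le> a * x" "0 \<le> b * y"
        using that by auto
      ultimately have "a * x + b * y + c \<in> {0..<int (X\<^sup>2) + 2 * (int X - 1)\<^sup>2}"
        using that unfolding power2_eq_square[of "int X - 1"] by auto
      then show ?thesis
        using that unfolding grid_points_def by force
    qed
    moreover have "grid_plane a b c \<in> grid_planes X" if "a \<in> ?G" "b \<in> ?G" "c \<in> ?C" for a b c
      using that unfolding grid_planes_def by force
    ultimately show "?F ` (?G \<times> ?G \<times> ?C \<times> ?G \<times> ?G)
        \<subseteq> {(h, p). h \<in> grid_planes X \<and> p \<in> grid_points X \<inter> h}"
      by auto
  qed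
  finally show ?thesis .
qed

text \<open>Two points of a common plane, with difference \<open>(u, v)\<close> in the first two coordinates, lie in
  a second plane whose slopes differ by \<open>(\<alpha>, \<beta>)\<close> only if \<open>\<alpha> u + \<beta> v = 0\<close>.\<close>

lemma card_grid_rectangles:
  assumes "X \<ge> 1"
  shows "card {(h, h', p, p'). h \<in> grid_planes X \<and> h' \<in> grid_planes X
      \<and> p \<in> grid_points X \<inter> h \<inter> h' \<and> p' \<in> grid_points X \<inter> h \<inter> h'}
    \<le> X ^ 6 * card (orthogonal_pairs X)" (is "card ?R \<le> _")
proof -
  let ?G = "{0..<int X}" and ?C = "{0..<int (X\<^sup>2)}"
  \<comment> \<open>\<open>?F\<close> rebuilds a quadruple from one plane, one base point and the
    differences to the other ones. The second intercept is forced because both planes pass through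
    the first point.\<close>
  let ?F = "\<lambda>(a, b, c, x, y, \<alpha>, \<beta>, u, v).
    (grid_plane a b c, grid_plane (a - \<alpha>) (b - \<beta>) (c + \<alpha> * x + \<beta> * y),
     grid_point x y (a * x + b * y + c), grid_point (x - u) (y - v) (a * (x - u) + b * (y - v) + c))"
  let ?K = "?G \<times> ?G \<times> ?C \<times> ?G \<times> ?G \<times> orthogonal_pairs X"
  have fin: "finite ?K"
    using card_orthogonal_pairs(2)[OF assms] by simp
  have "?R \<subseteq> ?F ` ?K"
  proof
    fix r
    assume "r \<in> ?R"
    then obtain h h' p p' where r: "r = (h, h', p, p')"
      and h: "h \<in> grid_planes X" "h' \<in> grid_planes X"
      and p: "p \<in> grid_points X" "p' \<in> grid_points X" "p \<in> h" "p \<in> h'" "p' \<in> h" "p' \<in> h'"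
      by auto
    obtain a b c where abc: "h = grid_plane a b c" "a \<in> ?G" "b \<in> ?G" "c \<in> ?C"
      using h(1) unfolding grid_planes_def by auto
    obtain a' b' c' where abc': "h' = grid_plane a' b' c'" "a' \<in> ?G" "b' \<in> ?G"
      using h(2) unfolding grid_planes_def by auto
    obtain x y z where xyz: "p = grid_point x y z" "x \<in> ?G" "y \<in> ?G"
      using p(1) unfolding grid_points_def by auto
    obtain x' y' z' where xyz': "p' = grid_point x' y' z'" "x' \<in> ?G" "y' \<in> ?G"
      using p(2) unfolding grid_points_def by auto
    have z: "z = a * x + b * y + c" "z = a' * x + b' * y + c'"
      "z' = a * x' + b * y' + c" "z' = a' * x' + b' * y' + c'"
      using p abc abc' xyz xyz' by auto
    have c': "c' = c + (a - a') * x + (b - b') * y"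
      using z by (simp add: algebra_simps)
    have "(a - a') * (x - x') + (b - b') * (y - y') = 0"
      using z by (simp add: algebra_simps)
    then have "(a - a', b - b', x - x', y - y') \<in> orthogonal_pairs X"
      using abc abc' xyz xyz' by (auto simp: orthogonal_pairs_def)
    then have "(a, b, c, x, y, a - a', b - b', x - x', y - y') \<in> ?K"
      using abc xyz by simp
    moreover have "r = ?F (a, b, c, x, y, a - a', b - b', x - x', y - y')"
      using r abc abc' xyz xyz' z c' by simp
    ultimately show "r \<in> ?F ` ?K"
      by (rule rev_image_eqI)
  qed
  then have "card ?R \<le> card ?K"
    using fin by (rule surj_card_le[rotated])
  also have "\<dots> = X ^ 6 * card (orthogonal_pairs X)"
    by (simp only: card_cartesian_product card_int_interval) (simp add: eval_nat_numeral)
  finally show ?thesis .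
qed

text \<open>The cube of \<open>X ^ 6\<close> incidences over a denominator of order
  \<open>X ^ 16 * ln n\<close> leaves \<open>X^2 / ln n\<close>. Using \<open>ln n\<close> instead
  of \<open>ln X\<close> keeps the denominator positive at \<open>X = 1\<close>.\<close>

lemma grid_gamma2_lower_bound:
  assumes X: "1 \<le> X" "X \<le> n" and n: "2 \<le> n"
    and ps: "distinct ps" "set ps = grid_points X" and hs: "distinct hs" "set hs = grid_planes X"
  shows "sqrt (real X ^ 2 / (972 * ln (real n))) \<le> gamma2 (incidence_mat hs ps)"
proof -
  let ?l = "ln (real n)"
  let ?I = "{(h, p). h \<in> grid_planes X \<and> p \<in> grid_points X \<inter> h}"
  let ?R = "{(h, h', p, p'). h \<in> grid_planes X \<and> h' \<in> grid_planes X
      \<and> p \<in> grid_points X \<inter> h \<inter> h' \<and> p' \<in> grid_points X \<inter> h \<inter> h'}"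
  \<comment> \<open>The factors bound the numbers of planes, points and quadruples;
    \<open>324 = 108 * 3\<close> combines the count of orthogonal pairs with the harmonic
    bound.\<close>
  define D where "D = real X ^ 4 * (3 * real X ^ 4) * (324 * real X ^ 8 * ?l)"
  have l: "?l > 0"
    using n by simp
  have D: "D > 0"
    using X l by (simp add: D_def)
  have "real (card (orthogonal_pairs X)) \<le> 108 * real X ^ 2 * (3 * ?l)"
    using card_orthogonal_pairs(1)[OF X(1)] harm_le_ln[OF X n]
    by (smt (verit) mult_left_mono zero_le_power2 zero_le_mult_iff)
  then have "real X ^ 6 * real (card (orthogonal_pairs X)) \<le> real X ^ 6 * (108 * real X ^ 2 * (3 * ?l))"
    by (intro mult_left_mono) auto
  moreover have "real (card ?R) \<le> real X ^ 6 * real (card (orthogonal_pairs X))"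
    using card_grid_rectangles[OF X(1)] by (simp flip: of_nat_power of_nat_mult)
  ultimately have R: "real (card ?R) \<le> 324 * real X ^ 8 * ?l"
    by (simp add: eval_nat_numeral mult_ac)
  have "card (grid_points X) \<le> 3 * X ^ 4"
    using card_grid_points[OF X(1)] grid_points_size_le[of X] by linarith
  then have P: "real (card (grid_points X)) \<le> 3 * real X ^ 4"
    by (simp flip: of_nat_power)
  have H: "real (card (grid_planes X)) \<le> real X ^ 4"
    using card_grid_planes by (simp flip: of_nat_power)
  have "real (card (grid_planes X)) * real (card (grid_points X)) * real (card ?R) \<le> D"
    unfolding D_def using P H R by (intro mult_mono) auto
  then have "sqrt (real (card ?I) ^ 3 / D) \<le> gamma2 (incidence_mat hs ps)"
    by (rule incidence_gamma2_lower_bound[OF ps hs _ D])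
  moreover have "real X ^ 2 / (972 * ?l) = (real X ^ 6) ^ 3 / D"
    using X l by (simp add: D_def divide_simps eval_nat_numeral)
  moreover have "(real X ^ 6) ^ 3 / D \<le> real (card ?I) ^ 3 / D"
    using card_grid_incidences[of X] D
    by (intro divide_right_mono power_mono) (simp_all flip: of_nat_power)
  ultimately show ?thesis
    by (smt (verit) real_sqrt_le_iff)
qed

section \<open>Choice of the grid size and conclusion\<close>

text \<open>Take the largest \<open>X\<close> with \<open>3 * X ^ 4 \<le> n\<close>, or
  \<open>X = 1\<close> if there is none. Maximality gives
  \<open>n < 3 * (X + 1) ^ 4 \<le> 48 * X ^ 4\<close>, which is below
  \<open>(3 * X) ^ 4\<close>.\<close>

lemma grid_size:
  assumes "2 \<le> n"
  obtains X :: nat where "1 \<le> X" "X ^ 4 \<le> n" "X\<^sup>2 * (X\<^sup>2 + 2 * (X - 1)\<^sup>2) \<le> n" "real n \<le> (3 * real X) ^ 4"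
proof -
  define Q where "Q X \<longleftrightarrow> X = 1 \<or> 3 * X ^ 4 \<le> n" for X
  have le: "X \<le> n" if "Q X" for X
  proof -
    have "X \<le> X ^ 4"
      by (cases "X = 0") (simp_all add: self_le_power)
    with that assms show ?thesis
      by (auto simp: Q_def)
  qed
  define X where "X = (GREATEST X. Q X)"
  have "Q 1"
    by (simp add: Q_def)
  then have X: "Q X" "1 \<le> X"
    unfolding X_def using le by (blast intro: GreatestI_nat Greatest_le_nat)+
  have "\<not> Q (X + 1)"
    using Greatest_le_nat[of Q "X + 1" n] le unfolding X_def by fastforce
  then have "n < 3 * (X + 1) ^ 4"
    by (simp add: Q_def)
  also have "\<dots> \<le> 3 * (2 * X) ^ 4"
    using X by (intro mult_left_mono power_mono) auto
  also have "\<dots> \<le> (3 * X) ^ 4"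
    by (simp add: power_mult_distrib)
  finally have "real n \<le> real ((3 * X) ^ 4)"
    by linarith
  then have "real n \<le> (3 * real X) ^ 4"
    by simp
  moreover have "X ^ 4 \<le> n \<and> X\<^sup>2 * (X\<^sup>2 + 2 * (X - 1)\<^sup>2) \<le> n"
  proof (cases "X = 1")
    case True
    with assms show ?thesis
      by simp
  next
    case False
    then have "3 * X ^ 4 \<le> n"
      using X by (simp add: Q_def)
    then show ?thesis
      using grid_points_size_le[of X] by linarith
  qed
  ultimately show thesis
    using X that by blast
qed

theorem theorem3p3:
  "\<exists>c::real. c > 0 \<and>
     (\<forall>n::nat. n \<ge> 2 \<longrightarrow>
        (\<exists>(P :: (real ^ 3) set) (H :: (real ^ 3) set set).
            finite P \<and> card P \<le> n \<and>
            finite H \<and> card H \<le> n \<and> (\<forall>h\<in>H. hyperplane h) \<and>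
            (\<forall>ps hs. distinct ps \<and> set ps = P \<and> distinct hs \<and> set hs = H \<longrightarrow>
               gamma2 (incidence_mat hs ps) \<ge> c * (real n powr (1 / 4) / sqrt (ln (real n))))))"
proof (intro exI[of _ "1 / 100"] conjI allI impI)
  fix n :: nat
  assume n: "2 \<le> n"
  obtain X where X: "1 \<le> X" "X ^ 4 \<le> n" "X\<^sup>2 * (X\<^sup>2 + 2 * (X - 1)\<^sup>2) \<le> n" "real n \<le> (3 * real X) ^ 4"
    using grid_size[OF n] by blast
  have "X \<le> X ^ 4"
    using X(1) by (simp add: self_le_power)
  with X(2) have Xn: "X \<le> n"
    by simp
  have l: "ln (real n) > 0"
    using n by simp
  have root: "(y ^ 4) powr (1 / 4) = y" if "y > 0" for y :: real
    using that by (simp add: powr_powr flip: powr_numeral)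
  have "real n powr (1 / 4) \<le> ((3 * real X) ^ 4) powr (1 / 4)"
    using X by (intro powr_mono2) auto
  also have "\<dots> = 3 * real X"
    using X by (intro root) simp
  finally have "1 / 100 * (real n powr (1 / 4) / sqrt (ln (real n)))
      \<le> 1 / 100 * (3 * real X / sqrt (ln (real n)))"
    using l by (intro mult_left_mono divide_right_mono) auto
  \<comment> \<open>After squaring, the constant \<open>1 / 100\<close> has to satisfy
    \<open>(3 / 100)^2 \<le> 1 / 972\<close>.\<close>
  also have "\<dots> \<le> sqrt (real X ^ 2 / (972 * ln (real n)))"
    using l by (intro real_le_rsqrt) (simp add: power_mult_distrib power_divide field_simps)
  finally have le: "1 / 100 * (real n powr (1 / 4) / sqrt (ln (real n)))
      \<le> sqrt (real X ^ 2 / (972 * ln (real n)))" .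
  show "\<exists>(P :: (real ^ 3) set) (H :: (real ^ 3) set set).
      finite P \<and> card P \<le> n \<and>
      finite H \<and> card H \<le> n \<and> (\<forall>h\<in>H. hyperplane h) \<and>
      (\<forall>ps hs. distinct ps \<and> set ps = P \<and> distinct hs \<and> set hs = H \<longrightarrow>
         1 / 100 * (real n powr (1 / 4) / sqrt (ln (real n))) \<le> gamma2 (incidence_mat hs ps))"
  proof (intro exI[of _ "grid_points X"] exI[of _ "grid_planes X"] conjI allI impI ballI)
    show "card (grid_points X) \<le> n" "card (grid_planes X) \<le> n"
      using card_grid_points[OF X(1)] card_grid_planes[of X] X by linarith+
    show "hyperplane h" if "h \<in> grid_planes X" for h
      using that hyperplane_grid_plane by (auto simp: grid_planes_def)
    show "1 / 100 * (real n powr (1 / 4) / sqrt (ln (real n))) \<le> gamma2 (incidence_mat hs ps)"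
      if "distinct ps \<and> set ps = grid_points X \<and> distinct hs \<and> set hs = grid_planes X" for ps hs
      using order_trans[OF le grid_gamma2_lower_bound[OF X(1) Xn n]] that by blast
  qed (rule finite_grid)+
qed simp

end
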